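(* Let $B\in\mathbb{R}^{n\times n}$ be the cubic B-spline collocation matrix associated with parameters $t_1<t_2<\cdots<t_n$, and let $Q=I+S$ be the preconditioner, where $S$ carries the negatives of the super-diagonal entries of $B$ (both as defined in the context). Then the preconditioned PIA $$\boldsymbol{p}^{(k+1)}=(I-QB)\,\boldsymbol{p}^{(k)}+Q\boldsymbol{p},\qquad k=0,1,2,\ldots,$$ is convergent, i.e. its iteration matrix satisfies $\rho(I-QB)<1$.
   Context: Data: points $\boldsymbol{p}_1,\ldots,\boldsymbol{p}_n$ in $\mathbb{R}^2$ or $\mathbb{R}^3$ with parameters $t_1<t_2<\cdots<t_n$. Extend the parameters to the knot vector $\{t_i\}_{i=-2}^{n+3}$ with $t_{-2}=t_{-1}=t_0=t_1<t_2<\cdots<t_n=t_{n+1}=t_{n+2}=t_{n+3}$. Let $\{N_i^3(t)\}_{i=-2}^{n-1}$ be the (normalized) cubic B-spline basis on this knot vector, where $N_i^3$ has support $[t_i,t_{i+4}]$. Collocation matrix: $B=(b_{ij})\in\mathbb{R}^{n\times n}$ is the tridiagonal matrix with $b_{11}=1$, $b_{12}=0$, $b_{n,n-1}=0$, $b_{nn}=1$, and for $2\le i\le n-1$: $b_{i,i-1}=N_{i-3}^3(t_i)$, $b_{ii}=N_{i-2}^3(t_i)$, $b_{i,i+1}=N_{i-1}^3(t_i)$; all other entries are $0$. Preconditioner: $Q=I+S$, where $S$ has entries $S_{i,i+1}=-b_{i,i+1}$ for $1\le i\le n-1$ (so $S_{12}=0$) and all other entries $0$. Write $\boldsymbol{p}=[\boldsymbol{p}_1,\ldots,\boldsymbol{p}_n]^T$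 (one data point per row), and $\boldsymbol{p}^{(k)}=[\boldsymbol{p}_1^{(k)},\ldots,\boldsymbol{p}_n^{(k)}]^T$ for the control points at step $k$. $\rho(\cdot)$ is the spectral radius. A stationary iteration $\boldsymbol{x}^{(k+1)}=G\boldsymbol{x}^{(k)}+\boldsymbol{c}$ is called convergent if its iteration matrix $G$ satisfies $\rho(G)<1$ (equivalently, the iterates converge for every initial guess and every $\boldsymbol{c}$). *)

theory Defs
  imports "Jordan_Normal_Form.Spectral_Radius"
begin

text \<open>
  Only \<open>t 1, \<dots>, t n\<close> are used; clamping the integer index to \<open>{1..n}\<close> gives each end
  parameter multiplicity four among the indices \<open>-2, \<dots>, n + 3\<close>.
\<close>

definition knot :: "nat \<Rightarrow> (nat \<Rightarrow> real) \<Rightarrow> int \<Rightarrow> real" where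
  "knot n t i = t (nat (max 1 (min (int n) i)))"

text \<open>
  Cox--de Boor recursion for the normalized B-spline of degree \<open>k\<close> with support
  \<open>[x i, x (i + k + 1)]\<close>. The usual convention that a term with vanishing denominator is dropped
  is division by zero in HOL. The half-open intervals at degree 0 make the value at the right end
  of the knot vector zero; below, splines are evaluated at interior knots only.
\<close>

fun bspline :: "(int \<Rightarrow> real) \<Rightarrow> nat \<Rightarrow> int \<Rightarrow> real \<Rightarrow> real" where
  "bspline x 0 i u = (if x i \<le> u \<and> u < x (i + 1) then 1 else 0)"
| "bspline x (Suc k) i u =
     (u - x i) / (x (i + int k + 1) - x i) * bspline x k i u +
     (x (i + int k + 2) - u) / (x (i + int k + 2) - x (i + 1)) * bspline x k (i + 1) u"

text \<open>Row and column numbers of \<open>colloc_entry\<close> start at 1, those of the type \<open>mat\<close> at 0.\<close>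

definition colloc_entry :: "nat \<Rightarrow> (nat \<Rightarrow> real) \<Rightarrow> nat \<Rightarrow> nat \<Rightarrow> real" where
  "colloc_entry n t i j =
     (if i = 1 \<or> i = n then (if j = i then 1 else 0)
      else if j + 1 = i then bspline (knot n t) 3 (int i - 3) (t i)
      else if j = i then bspline (knot n t) 3 (int i - 2) (t i)
      else if j = i + 1 then bspline (knot n t) 3 (int i - 1) (t i)
      else 0)"

definition colloc_mat :: "nat \<Rightarrow> (nat \<Rightarrow> real) \<Rightarrow> real mat" where
  "colloc_mat n t = mat n n (\<lambda>(i, j). colloc_entry n t (i + 1) (j + 1))"

definition neg_superdiag :: "real mat \<Rightarrow> real mat" where
  "neg_superdiag B =
     mat (dim_row B) (dim_col B) (\<lambda>(i, j). if j = i + 1 then - (B $$ (i, j)) else 0)"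

definition precond :: "nat \<Rightarrow> (nat \<Rightarrow> real) \<Rightarrow> real mat" where
  "precond n t = 1\<^sub>m n + neg_superdiag (colloc_mat n t)"

definition real_spectral_radius :: "real mat \<Rightarrow> real" where
  "real_spectral_radius A = spectral_radius (map_mat complex_of_real A)"

text \<open>
  An iteration \<open>X (k + 1) = F (X k)\<close> on \<open>n \<times> d\<close> matrices (one point of dimension \<open>d\<close> per row) is
  given by its step \<open>F\<close>. For \<open>d > 0\<close> the matrices \<open>G\<close> and \<open>c\<close> are uniquely determined by \<open>F\<close>.
\<close>

definition convergent_stationary_iteration ::
    "nat \<Rightarrow> nat \<Rightarrow> (real mat \<Rightarrow> real mat) \<Rightarrow> bool" where
  "convergent_stationary_iteration n d F \<longleftrightarrow>
     (\<exists>G \<in> carrier_mat n n. \<exists>c \<in> carrier_mat n d.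
        (\<forall>X \<in> carrier_mat n d. F X = G * X + c) \<and> real_spectral_radius G < 1)"

definition precond_pia_step ::
    "nat \<Rightarrow> (nat \<Rightarrow> real) \<Rightarrow> real mat \<Rightarrow> real mat \<Rightarrow> real mat" where
  "precond_pia_step n t p X =
     (1\<^sub>m n - precond n t * colloc_mat n t) * X + precond n t * p"

end

theory Submission
  imports Defs
begin

text \<open>
  For \<open>n \<ge> 2\<close> the matrix \<open>G = I - Q B\<close> is a contraction in a weighted maximum norm, with the
  explicit weights \<open>w i = t (i + 1) - t (i - 1)\<close>, where the knots beyond either end coincide with
  the end parameter. For \<open>n = 1\<close> it is zero.

  Two facts carry this. The first is about cubic B-splines. At an interior knot each of the
  three non-zero values is a product of two ratios of knot differences, or a sum of two such
  products. Once weighted, the two summands of the diagonal value \<open>d i\<close> dominate its neighbours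
  \<open>l i\<close> and \<open>u i\<close> one at a time: \<open>l i * w (i - 1) + u i * w (i + 1) < d i * w i\<close>. So although \<open>B\<close>
  itself need not be diagonally dominant, it becomes strictly so once its columns are scaled by
  \<open>w\<close> (\<open>bspline_cubic_weighted_dominance\<close>, \<open>colloc_entry_weighted_dominance\<close>).

  The second is algebraic. Let \<open>A\<close> be \<open>B\<close> with its off-diagonal signs reversed, so that the
  dominance says \<open>A w > 0\<close>. Conjugation by the diagonal matrix with the alternating signs
  \<open>(-1)^i\<close> turns the tridiagonal \<open>B\<close> into \<open>A\<close> and \<open>Q = I + S\<close> into the non-negative matrix
  \<open>I - S\<close>, hence \<open>G\<close> into \<open>I - (I - S) A\<close>, which is non-negative. This matrix therefore consists
  of the absolute values of the entries of \<open>G\<close>, and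
  \<open>(I - (I - S) A) w = w - A w - (-S) (A w) < w\<close>.
  For an arbitrary non-negative \<open>B\<close> with diagonal entries at most one, the matrix
  \<open>I - (I - S) A\<close> still bounds the absolute values of the entries of \<open>G\<close>, so the same estimate
  holds (\<open>precond_residual_entry_bound\<close>, \<open>spectral_radius_precond_lt_1\<close>).
\<close>

section \<open>Spectral radius and weighted row sums\<close>

text \<open>
  In an eigenvector \<open>v\<close> for an eigenvalue of largest modulus, take the row \<open>i\<close> where
  \<open>norm (v $ i) / w i\<close> is largest and read the eigenvalue equation there.
\<close>

lemma real_spectral_radius_lt_1_if_weighted_row_sums:
  fixes A :: "real mat" and w :: "nat \<Rightarrow> real"
  assumes A: "A \<in> carrier_mat n n" and n: "n > 0"
    and w: "\<And>i. i < n \<Longrightarrow> w i > 0"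
    and rows: "\<And>i. i < n \<Longrightarrow> (\<Sum>j<n. \<bar>A $$ (i, j)\<bar> * w j) < w i"
  shows "real_spectral_radius A < 1"
proof -
  let ?C = "map_mat complex_of_real A"
  have C: "?C \<in> carrier_mat n n" using A by simp
  obtain lam where lam: "eigenvalue ?C lam" "spectral_radius ?C = norm lam"
    using spectral_radius_mem_max(1)[OF C n] unfolding spectrum_def by auto
  then obtain v where v: "v \<in> carrier_vec n" "v \<noteq> 0\<^sub>v n" "?C *\<^sub>v v = lam \<cdot>\<^sub>v v"
    using C unfolding eigenvalue_def eigenvector_def by auto
  define m where "m = Max ((\<lambda>i. norm (v $ i) / w i) ` {..<n})"
  have "m \<in> (\<lambda>i. norm (v $ i) / w i) ` {..<n}"
    unfolding m_def using n by (intro Max_in) auto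
  then obtain i where i: "i < n" "m = norm (v $ i) / w i" by auto
  have bound: "norm (v $ j) \<le> m * w j" if "j < n" for j
  proof -
    have "norm (v $ j) / w j \<le> m" unfolding m_def using that by (intro Max_ge) auto
    then show ?thesis using w[OF that] by (simp add: field_simps)
  qed
  have m_pos: "m > 0"
  proof (rule ccontr)
    assume "\<not> m > 0"
    then have "norm (v $ j) \<le> 0" if "j < n" for j
      using bound[OF that] w[OF that] mult_nonpos_nonneg[of m "w j"] by linarith
    then have "v = 0\<^sub>v n" using v(1) by (intro eq_vecI) auto
    with v(2) show False by simp
  qed
  have "lam * v $ i = (\<Sum>j<n. complex_of_real (A $$ (i, j)) * v $ j)"
  proof -
    have "lam * v $ i = (?C *\<^sub>v v) $ i" using v i by simp
    also have "\<dots> = (\<Sum>j<n. complex_of_real (A $$ (i, j)) * v $ j)"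
      using A v(1) i by (simp add: scalar_prod_def atLeast0LessThan)
    finally show ?thesis .
  qed
  then have "norm lam * norm (v $ i) = norm (\<Sum>j<n. complex_of_real (A $$ (i, j)) * v $ j)"
    by (metis norm_mult)
  also have "\<dots> \<le> (\<Sum>j<n. \<bar>A $$ (i, j)\<bar> * norm (v $ j))"
    by (rule order_trans[OF norm_sum]) (simp add: norm_mult)
  also have "\<dots> \<le> (\<Sum>j<n. \<bar>A $$ (i, j)\<bar> * (m * w j))"
    by (intro sum_mono mult_left_mono bound) auto
  also have "\<dots> = m * (\<Sum>j<n. \<bar>A $$ (i, j)\<bar> * w j)"
    by (simp add: sum_distrib_left mult_ac)
  also have "\<dots> < m * w i" using rows[OF i(1)] m_pos by simp
  also have "m * w i = norm (v $ i)" using i w[OF i(1)] by simp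
  finally have "norm lam * norm (v $ i) < 1 * norm (v $ i)" by simp
  then have "norm lam < 1" by (rule mult_right_less_imp_less) simp
  then show ?thesis using lam by (simp add: real_spectral_radius_def)
qed

section \<open>Preconditioning a weighted diagonally dominant matrix\<close>

text \<open>
  The right-hand side below is \<open>(I - (I - S) A) $$ (i, j)\<close> for the matrix \<open>A\<close> obtained from \<open>B\<close> by
  reversing the off-diagonal signs; the last row has no superdiagonal entry. On the diagonal and
  the superdiagonal, \<open>B $$ (k, k) \<le> 1\<close> determines the sign of the entry on the left, and the two
  sides are equal. Elsewhere the bound is the triangle inequality.
\<close>

lemma precond_residual_entry_bound:
  fixes B :: "real mat"
  defines "A \<equiv> \<lambda>i j. if j = i then B $$ (i, j) else - B $$ (i, j)"
  assumes B: "B \<in> carrier_mat n n"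
    and nonneg: "\<And>i j. i < n \<Longrightarrow> j < n \<Longrightarrow> B $$ (i, j) \<ge> 0"
    and diag: "\<And>i. i < n \<Longrightarrow> B $$ (i, i) \<le> 1"
    and i: "i < n" and j: "j < n"
  shows "\<bar>(1\<^sub>m n - (1\<^sub>m n + neg_superdiag B) * B) $$ (i, j)\<bar>
    \<le> (if j = i then 1 else 0) - A i j
       - (if Suc i < n then B $$ (i, Suc i) * A (Suc i) j else 0)"
proof -
  have S: "neg_superdiag B \<in> carrier_mat n n"
    using B by (auto simp: neg_superdiag_def)
  have "(neg_superdiag B * B) $$ (i, j)
      = (\<Sum>k<n. (if k = Suc i then - B $$ (i, k) else 0) * B $$ (k, j))"
    using B i j by (simp add: neg_superdiag_def scalar_prod_def atLeast0LessThan)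
  also have "\<dots> = (\<Sum>k<n. if k = Suc i then - B $$ (i, k) * B $$ (k, j) else 0)"
    by (intro sum.cong) auto
  also have "\<dots> = (if Suc i < n then - B $$ (i, Suc i) * B $$ (Suc i, j) else 0)"
    by (subst sum.delta) auto
  finally have SB: "(neg_superdiag B * B) $$ (i, j)
      = (if Suc i < n then - B $$ (i, Suc i) * B $$ (Suc i, j) else 0)" .
  have "(1\<^sub>m n + neg_superdiag B) * B = B + neg_superdiag B * B"
    using B S by (simp add: add_mult_distrib_mat[of _ n n])
  then have G: "(1\<^sub>m n - (1\<^sub>m n + neg_superdiag B) * B) $$ (i, j)
      = (if j = i then 1 else 0) - B $$ (i, j)
        + (if Suc i < n then B $$ (i, Suc i) * B $$ (Suc i, j) else 0)"
    using B S i j SB by auto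
  have prod_nonneg: "B $$ (i, Suc i) * B $$ (Suc i, j) \<ge> 0" if "Suc i < n"
    using nonneg[OF i that] nonneg[OF that j] by simp
  consider "j = i" | "j = Suc i" | "j \<noteq> i" "j \<noteq> Suc i" by blast
  then show ?thesis
  proof cases
    case 1
    then show ?thesis
      unfolding G A_def using diag[OF i] prod_nonneg by auto
  next
    case 2
    then have "B $$ (i, j) * B $$ (j, j) \<le> B $$ (i, j) * 1"
      using j diag[OF j] nonneg[OF i j] by (intro mult_left_mono) auto
    with 2 show ?thesis unfolding G A_def using j by auto
  next
    case 3
    then show ?thesis
      unfolding G A_def using nonneg[OF i j] prod_nonneg by auto
  qed
qed

text \<open>
  Summed against \<open>w\<close>, the entry bounds for row \<open>i\<close> give \<open>w i\<close> minus the \<open>i\<close>-th entry of \<open>A w\<close>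
  minus a non-negative multiple of the next entry of \<open>A w\<close>. The dominance hypothesis is \<open>A w > 0\<close>.
\<close>

theorem spectral_radius_precond_lt_1:
  fixes B :: "real mat" and w :: "nat \<Rightarrow> real"
  assumes B: "B \<in> carrier_mat n n" and n: "n > 0"
    and nonneg: "\<And>i j. i < n \<Longrightarrow> j < n \<Longrightarrow> B $$ (i, j) \<ge> 0"
    and diag: "\<And>i. i < n \<Longrightarrow> B $$ (i, i) \<le> 1"
    and w: "\<And>i. i < n \<Longrightarrow> w i > 0"
    and dom: "\<And>i. i < n \<Longrightarrow> (\<Sum>j\<in>{..<n} - {i}. B $$ (i, j) * w j) < B $$ (i, i) * w i"
  shows "real_spectral_radius (1\<^sub>m n - (1\<^sub>m n + neg_superdiag B) * B) < 1"
proof (rule real_spectral_radius_lt_1_if_weighted_row_sums[OF _ n w])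
  show "1\<^sub>m n - (1\<^sub>m n + neg_superdiag B) * B \<in> carrier_mat n n"
    using B by (auto simp: neg_superdiag_def)
next
  fix i assume i: "i < n"
  let ?G = "1\<^sub>m n - (1\<^sub>m n + neg_superdiag B) * B"
  define A where "A i j = (if j = i then B $$ (i, j) else - B $$ (i, j))" for i j
  define u where "u = (if Suc i < n then B $$ (i, Suc i) else 0)"
  have Aw: "(\<Sum>j<n. A k j * w j) > 0" if "k < n" for k
  proof -
    have "(\<Sum>j<n. A k j * w j) = A k k * w k + (\<Sum>j\<in>{..<n} - {k}. A k j * w j)"
      using that by (intro sum.remove) auto
    also have "(\<Sum>j\<in>{..<n} - {k}. A k j * w j) = - (\<Sum>j\<in>{..<n} - {k}. B $$ (k, j) * w j)"
      unfolding sum_negf[symmetric] by (intro sum.cong) (auto simp: A_def)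
    finally show ?thesis using dom[OF that] by (simp add: A_def)
  qed
  have "(\<Sum>j<n. \<bar>?G $$ (i, j)\<bar> * w j)
      \<le> (\<Sum>j<n. ((if j = i then 1 else 0) - A i j - u * A (Suc i) j) * w j)"
  proof (intro sum_mono mult_right_mono)
    fix j assume "j \<in> {..<n}"
    then have j: "j < n" by simp
    show "\<bar>?G $$ (i, j)\<bar> \<le> (if j = i then 1 else 0) - A i j - u * A (Suc i) j"
      using precond_residual_entry_bound[OF B nonneg diag i j]
      unfolding A_def u_def by (cases "Suc i < n") simp_all
    show "0 \<le> w j" using w[OF j] by simp
  qed
  also have "\<dots> = (\<Sum>j<n. if j = i then w j else 0)
      - (\<Sum>j<n. A i j * w j) - u * (\<Sum>j<n. A (Suc i) j * w j)"
    unfolding sum_distrib_left sum_subtractf[symmetric]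
    by (intro sum.cong) (auto simp: algebra_simps)
  also have "(\<Sum>j<n. if j = i then w j else 0) = w i" using i by simp
  also have "w i - (\<Sum>j<n. A i j * w j) - u * (\<Sum>j<n. A (Suc i) j * w j) < w i"
  proof -
    have "u * (\<Sum>j<n. A (Suc i) j * w j) \<ge> 0"
      using Aw[of "Suc i"] nonneg[OF i, of "Suc i"] by (auto simp: u_def intro: mult_nonneg_nonneg)
    with Aw[OF i] show ?thesis by linarith
  qed
  finally show "(\<Sum>j<n. \<bar>?G $$ (i, j)\<bar> * w j) < w i" .
qed

section \<open>Cubic B-splines at a simple knot\<close>

context
  fixes x :: "int \<Rightarrow> real" and i :: int
  assumes mono_x: "mono x" and below: "x (i - 1) < x i" and above: "x i < x (i + 1)"
begin

lemma bspline_0_at_knot: "bspline x 0 j (x i) = (if j = i then 1 else 0)"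
proof -
  have "x (j + 1) \<le> x i" if "j < i" using monoD[OF mono_x, of "j + 1" i] that by simp
  moreover have "x (i + 1) \<le> x j" if "i < j" using monoD[OF mono_x, of "i + 1" j] that by simp
  ultimately show ?thesis using above by (cases j i rule: linorder_cases) auto
qed

lemma bspline_1_at_knot: "bspline x 1 j (x i) = (if j = i - 1 then 1 else 0)"
  using above bspline_0_at_knot by (auto simp: One_nat_def add.commute simp del: bspline.simps(1))

lemma bspline_2_at_knot:
  "bspline x 2 j (x i) =
    (if j = i - 2 then (x (i + 1) - x i) / (x (i + 1) - x (i - 1))
     else if j = i - 1 then (x i - x (i - 1)) / (x (i + 1) - x (i - 1)) else 0)"
proof -
  have "bspline x 2 j (x i) =
     (x i - x j) / (x (j + 2) - x j) * bspline x 1 j (x i) +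
     (x (j + 3) - x i) / (x (j + 3) - x (j + 1)) * bspline x 1 (j + 1) (x i)"
    using bspline.simps(2)[of x 1 j "x i"]
    by (simp add: numeral_2_eq_2 add.assoc del: bspline.simps)
  then show ?thesis
    unfolding bspline_1_at_knot using below above by (auto simp: add.commute)
qed

lemma bspline_3_at_knot:
  "bspline x 3 (i - 3) (x i) =
    (x (i + 1) - x i) / (x (i + 1) - x (i - 2)) * ((x (i + 1) - x i) / (x (i + 1) - x (i - 1)))"
  "bspline x 3 (i - 2) (x i) =
    (x i - x (i - 2)) / (x (i + 1) - x (i - 2)) * ((x (i + 1) - x i) / (x (i + 1) - x (i - 1)))
    + (x (i + 2) - x i) / (x (i + 2) - x (i - 1)) * ((x i - x (i - 1)) / (x (i + 1) - x (i - 1)))"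
  "bspline x 3 (i - 1) (x i) =
    (x i - x (i - 1)) / (x (i + 2) - x (i - 1)) * ((x i - x (i - 1)) / (x (i + 1) - x (i - 1)))"
proof -
  have step: "bspline x 3 j (x i) =
     (x i - x j) / (x (j + 3) - x j) * bspline x 2 j (x i) +
     (x (j + 4) - x i) / (x (j + 4) - x (j + 1)) * bspline x 2 (j + 1) (x i)" for j
    using bspline.simps(2)[of x 2 j "x i"]
    by (simp add: numeral_3_eq_3 numeral_2_eq_2 add.assoc del: bspline.simps)
  show "bspline x 3 (i - 3) (x i) =
    (x (i + 1) - x i) / (x (i + 1) - x (i - 2)) * ((x (i + 1) - x i) / (x (i + 1) - x (i - 1)))"
    by (subst step) (simp add: bspline_2_at_knot add.commute)
  show "bspline x 3 (i - 2) (x i) =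
    (x i - x (i - 2)) / (x (i + 1) - x (i - 2)) * ((x (i + 1) - x i) / (x (i + 1) - x (i - 1)))
    + (x (i + 2) - x i) / (x (i + 2) - x (i - 1)) * ((x i - x (i - 1)) / (x (i + 1) - x (i - 1)))"
    by (subst step) (simp add: bspline_2_at_knot add.commute)
  show "bspline x 3 (i - 1) (x i) =
    (x i - x (i - 1)) / (x (i + 2) - x (i - 1)) * ((x i - x (i - 1)) / (x (i + 1) - x (i - 1)))"
    by (subst step) (simp add: bspline_2_at_knot add.commute)
qed

lemma knots_near:
  "x (i - 2) \<le> x (i - 1)" "x (i + 1) \<le> x (i + 2)"
  using mono_x by (auto intro: monoD)

lemma bspline_cubic_at_knot_nonneg:
  "bspline x 3 (i - 3) (x i) \<ge> 0" "bspline x 3 (i - 2) (x i) \<ge> 0" "bspline x 3 (i - 1) (x i) \<ge> 0"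
  using knots_near below above unfolding bspline_3_at_knot by simp_all

text \<open>The middle value is a convex combination of two numbers that are at most one.\<close>

lemma bspline_cubic_at_knot_le_1: "bspline x 3 (i - 2) (x i) \<le> 1"
proof -
  define p where "p = (x (i + 1) - x i) / (x (i + 1) - x (i - 1))"
  define q where "q = (x i - x (i - 1)) / (x (i + 1) - x (i - 1))"
  have pq: "p \<ge> 0" "q \<ge> 0" "p + q = 1"
    using below above unfolding p_def q_def by (auto simp: add_divide_distrib[symmetric])
  have "bspline x 3 (i - 2) (x i) \<le> 1 * p + 1 * q"
    unfolding bspline_3_at_knot p_def[symmetric] q_def[symmetric]
    using knots_near below above pq by (intro add_mono mult_right_mono) auto
  then show ?thesis using pq by simp
qed

text \<open>
  With \<open>a = x (i + 1) - x i\<close>, \<open>b = x i - x (i - 1)\<close> and \<open>c = x i - x (i - 2)\<close>, the left value shares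
  the factor \<open>a / ((a + b) (a + c))\<close> with the first summand of the middle value. Dividing the
  weighted terms by it leaves \<open>a c < c (a + b)\<close>: the weight \<open>c\<close> of the left value is the other
  factor of the summand it is compared with, so what remains is \<open>a < a + b\<close>. The right value
  compares to the second summand in the same way.
\<close>

lemma bspline_cubic_weighted_dominance:
  "bspline x 3 (i - 3) (x i) * (x i - x (i - 2)) + bspline x 3 (i - 1) (x i) * (x (i + 2) - x i)
    < bspline x 3 (i - 2) (x i) * (x (i + 1) - x (i - 1))"
proof -
  define a where "a = x (i + 1) - x i"
  define b where "b = x i - x (i - 1)"
  define c where "c = x i - x (i - 2)"
  define e where "e = x (i + 2) - x i"
  have pos: "a > 0" "b > 0" "c > 0" "e > 0"
    using knots_near below above unfolding a_def b_def c_def e_def by linarith+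
  have diffs: "x (i + 1) - x (i - 1) = a + b" "x (i + 1) - x (i - 2) = c + a"
    "x (i + 2) - x (i - 1) = b + e"
    unfolding a_def b_def c_def e_def by simp_all
  have left: "a / (c + a) * (a / (a + b)) * c < c / (c + a) * (a / (a + b)) * (a + b)"
  proof -
    have "a * c / ((c + a) * (a + b)) * a < a * c / ((c + a) * (a + b)) * (a + b)"
      using pos by (intro mult_strict_left_mono) auto
    then show ?thesis by (simp add: mult_ac)
  qed
  have right: "b / (b + e) * (b / (a + b)) * e < e / (b + e) * (b / (a + b)) * (a + b)"
  proof -
    have "b * e / ((b + e) * (a + b)) * b < b * e / ((b + e) * (a + b)) * (a + b)"
      using pos by (intro mult_strict_left_mono) auto
    then show ?thesis by (simp add: mult_ac)
  qed
  show ?thesis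
    unfolding bspline_3_at_knot diffs a_def[symmetric] b_def[symmetric] c_def[symmetric]
      e_def[symmetric]
    using left right by (simp only: distrib_right)
qed

end

section \<open>The collocation matrix\<close>

lemma mono_knot:
  assumes "n \<ge> 1" "strict_mono_on {1..n} t"
  shows "mono (knot n t)"
proof
  fix i j :: int assume "i \<le> j"
  then show "knot n t i \<le> knot n t j"
    unfolding knot_def using assms(1)
    by (intro strict_mono_on_leD[OF assms(2)]) (auto simp: nat_le_iff le_nat_iff)
qed

lemma knot_less_knot:
  assumes "strict_mono_on {1..n} t" "i < j" "i < int n" "1 < j" "n \<ge> 2"
  shows "knot n t i < knot n t j"
  unfolding knot_def using assms(2-)
  by (intro strict_mono_onD[OF assms(1)]) (auto simp: nat_le_iff le_nat_iff)

lemma knot_of_nat: "1 \<le> i \<Longrightarrow> i \<le> n \<Longrightarrow> knot n t (int i) = t i"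
  by (simp add: knot_def)

context
  fixes n :: nat and t :: "nat \<Rightarrow> real" and i :: nat
  assumes strict: "strict_mono_on {1..n} t" and interior: "1 < i" "i < n"
begin

lemma interior_knot:
  "mono (knot n t)" "knot n t (int i - 1) < knot n t (int i)"
  "knot n t (int i) < knot n t (int i + 1)"
  using interior by (auto intro!: mono_knot knot_less_knot strict)

lemma colloc_entry_interior:
  "colloc_entry n t i j =
    (if j + 1 = i then bspline (knot n t) 3 (int i - 3) (knot n t (int i))
     else if j = i then bspline (knot n t) 3 (int i - 2) (knot n t (int i))
     else if j = i + 1 then bspline (knot n t) 3 (int i - 1) (knot n t (int i))
     else 0)"
  using interior knot_of_nat[of i n t] by (simp add: colloc_entry_def)

lemma colloc_entry_weighted_dominance:
  fixes w :: "nat \<Rightarrow> real"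
  defines "w \<equiv> \<lambda>j. knot n t (int j + 1) - knot n t (int j - 1)"
  shows "colloc_entry n t i (i - 1) * w (i - 1) + colloc_entry n t i (i + 1) * w (i + 1)
    < colloc_entry n t i i * w i"
  using bspline_cubic_weighted_dominance[OF interior_knot] interior
  by (simp add: colloc_entry_interior w_def of_nat_diff add.commute)

end

lemma colloc_entry_nonneg:
  assumes "strict_mono_on {1..n} t" "1 \<le> i" "i \<le> n"
  shows "colloc_entry n t i j \<ge> 0"
proof (cases "i = 1 \<or> i = n")
  case True
  then show ?thesis by (auto simp: colloc_entry_def)
next
  case False
  then have "1 < i" "i < n" using assms by auto
  note int = assms(1) this
  show ?thesis
    using bspline_cubic_at_knot_nonneg[OF interior_knot[OF int]]
    by (simp add: colloc_entry_interior[OF int])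
qed

lemma colloc_entry_diag_le_1:
  assumes "strict_mono_on {1..n} t" "1 \<le> i" "i \<le> n"
  shows "colloc_entry n t i i \<le> 1"
proof (cases "i = 1 \<or> i = n")
  case True
  then show ?thesis by (auto simp: colloc_entry_def)
next
  case False
  then have "1 < i" "i < n" using assms by auto
  note int = assms(1) this
  show ?thesis
    using bspline_cubic_at_knot_le_1[OF interior_knot[OF int]]
    by (simp add: colloc_entry_interior[OF int])
qed

theorem spectral_radius_precond_colloc_lt_1:
  assumes n: "n \<ge> 1" and strict: "strict_mono_on {1..n} t"
  shows "real_spectral_radius (1\<^sub>m n - precond n t * colloc_mat n t) < 1"
  unfolding precond_def
proof (rule spectral_radius_precond_lt_1)
  let ?B = "colloc_mat n t"
  \<comment> \<open>For a single parameter all knots coincide, and any positive weight will do.\<close>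
  define v where "v i = (if n = 1 then 1 else knot n t (int i + 1) - knot n t (int i - 1))" for i
  define w where "w j = v (j + 1)" for j
  have entry: "?B $$ (i, j) = colloc_entry n t (i + 1) (j + 1)" if "i < n" "j < n" for i j
    using that by (simp add: colloc_mat_def)
  show "?B \<in> carrier_mat n n" by (simp add: colloc_mat_def)
  show "n > 0" using n by simp
  show "?B $$ (i, j) \<ge> 0" if "i < n" "j < n" for i j
    using that by (simp add: entry colloc_entry_nonneg[OF strict])
  show "?B $$ (i, i) \<le> 1" if "i < n" for i
    using that by (simp add: entry colloc_entry_diag_le_1[OF strict])
  show w_pos: "w i > 0" if "i < n" for i
    using that by (auto simp: w_def v_def intro!: knot_less_knot[OF strict])
  show "(\<Sum>j\<in>{..<n} - {i}. ?B $$ (i, j) * w j) < ?B $$ (i, i) * w i" if i: "i < n" for i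
  proof (cases "i = 0 \<or> i + 1 = n")
    case True
    then have "(\<Sum>j\<in>{..<n} - {i}. ?B $$ (i, j) * w j) = 0"
      using i by (intro sum.neutral) (auto simp: entry colloc_entry_def)
    moreover have "?B $$ (i, i) = 1" using True i by (auto simp: entry colloc_entry_def)
    ultimately show ?thesis using w_pos[OF i] by simp
  next
    case False
    then have int: "1 < i + 1" "i + 1 < n" using i by auto
    have "?B $$ (i, j) = 0" if "j < n" "j \<noteq> i" "j \<notin> {i - 1, i + 1}" for j
      using that i False by (subst entry)
        (auto simp: colloc_entry_def)
    then have "(\<Sum>j\<in>{..<n} - {i}. ?B $$ (i, j) * w j) = (\<Sum>j\<in>{i - 1, i + 1}. ?B $$ (i, j) * w j)"
      using int by (intro sum.mono_neutral_right) auto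
    also have "\<dots> = ?B $$ (i, i - 1) * w (i - 1) + ?B $$ (i, i + 1) * w (i + 1)"
      by simp
    also have "\<dots> < ?B $$ (i, i) * w i"
      using colloc_entry_weighted_dominance[OF strict int] int
      by (simp add: entry w_def v_def)
    finally show ?thesis .
  qed
qed

theorem theorem2:
  fixes n d :: nat and t :: "nat \<Rightarrow> real" and p :: "real mat"
  assumes "n \<ge> 1"
    and "strict_mono_on {1..n} t"
    and "d = 2 \<or> d = 3"
    and "p \<in> carrier_mat n d"
  shows "convergent_stationary_iteration n d (precond_pia_step n t p)
    \<and> real_spectral_radius (1\<^sub>m n - precond n t * colloc_mat n t) < 1"
proof -
  let ?G = "1\<^sub>m n - precond n t * colloc_mat n t"
  have radius: "real_spectral_radius ?G < 1"
    using spectral_radius_precond_colloc_lt_1 assms by blast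
  have B: "colloc_mat n t \<in> carrier_mat n n" by (simp add: colloc_mat_def)
  then have Q: "precond n t \<in> carrier_mat n n" by (auto simp: precond_def neg_superdiag_def)
  have "?G \<in> carrier_mat n n" "precond n t * p \<in> carrier_mat n d"
    using B Q assms(4) by auto
  then have "convergent_stationary_iteration n d (precond_pia_step n t p)"
    unfolding convergent_stationary_iteration_def precond_pia_step_def
    using radius by blast
  with radius show ?thesis by blast
qed

end
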